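(* Let $L\subset\mathbb{R}^2$ be a lattice with angle $\theta\in[\pi/3,\pi/2]$ and successive minima $\lambda_1$ and $\lambda_2=\alpha\lambda_1$ for some $\alpha\ge 1$, and let $H(L)$ be the deep hole lattice of $L$. Then: (1) if $\alpha\le 2\sin(\theta+\pi/6)$, then $H(L)$ is well-rounded; (2) if $L$ is semi-stable, then $H(L)$ is well-rounded; (3) if $L$ is well-rounded, then $H(L)$ is similar to $L$; (4) if $L\subset K^2$ for some subfield $K$ of $\mathbb{R}$, then $H(L)\subset K^2$.
   Context: For a lattice $L\subset\mathbb{R}^2$ with successive minima $\lambda_1\le\lambda_2$, let $\boldsymbol{x}_1,\boldsymbol{x}_2$ be minimal basis vectors ($\|\boldsymbol{x}_i\|=\lambda_i$), chosen (replacing by $\pm\boldsymbol{x}_i$ if necessary) so that the angle $\theta$ between them lies in $[\pi/3,\pi/2]$; $\theta$ is called the angle of $L$. $L$ is well-rounded if $\lambda_1=\lambda_2$, and semi-stable if $\lambda_1\ge \det(L)^{1/2}$. Lattices $L_1,L_2$ are similar if $L_2=cUL_1$ for some $c>0$ and $U\in O_2(\mathbb{R})$. A deep hole of $L$ is a point of $\mathbb{R}^2$ at maximal distance from $L$. The fundamental deep hole $\boldsymbol{z}$ of $L$ is the unique deep hole lying in the triangle with vertices $\boldsymbol{0},\boldsymbol{x}_1,\boldsymbol{x}_2$. The deep hole lattice is $H(L)=\operatorname{span}_{\mathbb{Z}}\{\boldsymbol{x}_1,\boldsymbol{z}\}$. *)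

theory Defs
  imports "HOL-Analysis.Analysis"
begin

definition int_span2 :: "real^2 \<Rightarrow> real^2 \<Rightarrow> (real^2) set" where
  "int_span2 u v = {of_int m *\<^sub>R u + of_int n *\<^sub>R v | (m::int) (n::int). True}"

definition lattice_basis :: "(real^2) set \<Rightarrow> real^2 \<Rightarrow> real^2 \<Rightarrow> bool" where
  "lattice_basis L u v \<longleftrightarrow> u \<noteq> v \<and> independent {u, v} \<and> L = int_span2 u v"

text \<open>Lattices are of full rank.\<close>

definition is_lattice :: "(real^2) set \<Rightarrow> bool" where
  "is_lattice L \<longleftrightarrow> (\<exists>u v. lattice_basis L u v)"

text \<open>The value is independent of the choice of the basis.\<close>

definition lattice_det :: "(real^2) set \<Rightarrow> real" where
  "lattice_det L =
     (THE d. \<exists>u v. lattice_basis L u v \<and> d = \<bar>det (vector [u, v] :: real^2^2)\<bar>)"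

definition successive_minimum :: "(real^2) set \<Rightarrow> nat \<Rightarrow> real" where
  "successive_minimum L i = Inf {r. 0 \<le> r \<and> i \<le> dim (L \<inter> cball 0 r)}"

definition minimal_basis :: "(real^2) set \<Rightarrow> real^2 \<Rightarrow> real^2 \<Rightarrow> bool" where
  "minimal_basis L x1 x2 \<longleftrightarrow> lattice_basis L x1 x2 \<and>
     norm x1 = successive_minimum L 1 \<and> norm x2 = successive_minimum L 2"

definition vec_angle :: "real^2 \<Rightarrow> real^2 \<Rightarrow> real" where
  "vec_angle x y = arccos (x \<bullet> y / (norm x * norm y))"

definition well_rounded :: "(real^2) set \<Rightarrow> bool" where
  "well_rounded L \<longleftrightarrow> is_lattice L \<and> successive_minimum L 1 = successive_minimum L 2"

definition semi_stable :: "(real^2) set \<Rightarrow> bool" where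
  "semi_stable L \<longleftrightarrow> is_lattice L \<and> successive_minimum L 1 \<ge> sqrt (lattice_det L)"

definition similar_to :: "(real^2) set \<Rightarrow> (real^2) set \<Rightarrow> bool" where
  "similar_to L1 L2 \<longleftrightarrow>
     (\<exists>c U. c > 0 \<and> orthogonal_matrix (U :: real^2^2) \<and> L2 = (\<lambda>x. c *\<^sub>R (U *v x)) ` L1)"

definition deep_hole :: "(real^2) set \<Rightarrow> real^2 \<Rightarrow> bool" where
  "deep_hole L p \<longleftrightarrow> (\<forall>q. infdist q L \<le> infdist p L)"

definition fundamental_deep_hole :: "(real^2) set \<Rightarrow> real^2 \<Rightarrow> real^2 \<Rightarrow> real^2" where
  "fundamental_deep_hole L x1 x2 = (THE z. deep_hole L z \<and> z \<in> convex hull {0, x1, x2})"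

text \<open>
  The minimal basis is an explicit argument: different minimal bases of the same lattice may
  yield different (congruent) deep hole lattices.
\<close>

definition deep_hole_lattice :: "(real^2) set \<Rightarrow> real^2 \<Rightarrow> real^2 \<Rightarrow> (real^2) set" where
  "deep_hole_lattice L x1 x2 = int_span2 x1 (fundamental_deep_hole L x1 x2)"

definition real_subfield :: "real set \<Rightarrow> bool" where
  "real_subfield K \<longleftrightarrow> 0 \<in> K \<and> 1 \<in> K \<and>
     (\<forall>x\<in>K. \<forall>y\<in>K. x - y \<in> K \<and> x * y \<in> K) \<and> (\<forall>x\<in>K. inverse x \<in> K)"

definition cartesian_square :: "real set \<Rightarrow> (real^2) set" where
  "cartesian_square K = {v. \<forall>i. v $ i \<in> K}"

end

theory Submission
  imports Defs
begin

text \<open>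
  Write \<open>a = x1 \<bullet> x1\<close>, \<open>b = x1 \<bullet> x2\<close>, \<open>c = x2 \<bullet> x2\<close>,
  so that \<open>0 \<le> 2b \<le> a \<le> c\<close> for an acute minimal basis. The fundamental deep hole is the
  circumcenter \<open>z\<close> of the triangle \<open>0, x1, x2\<close>: by the parallel axis identity every point \<open>p\<close> of
  the triangle has a vertex at squared distance at most \<open>|z|\<^sup>2 - |p - z|\<^sup>2\<close>, the triangle and its
  mirror image tile the plane modulo \<open>L\<close>, and no lattice point is closer to \<open>z\<close> than \<open>0\<close>. Since
  \<open>2 (z \<bullet> x1) = a\<close>, the vectors \<open>z\<close> and \<open>x1 - z\<close> form a basis of \<open>H(L)\<close> with equal lengths.
  Hence \<open>H(L)\<close> is well-rounded as soon as \<open>a \<le> 3|z|\<^sup>2\<close>, which always holds, and \<open>|z|\<^sup>2 \<le> a\<close>, which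
  reads \<open>c (a + c - 2b) \<le> 4 (ac - b\<^sup>2)\<close>. If \<open>a = c\<close>, the Gram matrix of \<open>(z, x1 - z)\<close> is a multiple
  of that of \<open>(x1, x2)\<close>.
\<close>

section \<open>Pairs of vectors in the plane\<close>

lemma det_vector_2: "det (vector [u, v] :: real^2^2) = u $ 1 * v $ 2 - u $ 2 * v $ 1"
  by (simp add: det_2)

lemma inner_real2: "u \<bullet> v = u $ 1 * v $ 1 + u $ 2 * v $ 2" for u v :: "real^2"
  by (simp add: inner_vec_def sum_2)

lemma det_squared_eq_gram:
  "(det (vector [u, v] :: real^2^2))\<^sup>2 = (u \<bullet> u) * (v \<bullet> v) - (u \<bullet> v)\<^sup>2" for u v :: "real^2"
  unfolding det_vector_2 inner_real2 by (simp add: power2_eq_square algebra_simps)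

lemma independent_pair_iff_det:
  "u \<noteq> v \<and> independent {u, v} \<longleftrightarrow> det (vector [u, v] :: real^2^2) \<noteq> 0" for u v :: "real^2"
proof
  assume *: "u \<noteq> v \<and> independent {u, v}"
  then have v: "v \<noteq> 0" and u: "u \<notin> span {v}"
    by (auto simp: independent_insert)
  show "det (vector [u, v] :: real^2^2) \<noteq> 0"
  proof
    assume "det (vector [u, v] :: real^2^2) = 0"
    then have d: "u $ 1 * v $ 2 = u $ 2 * v $ 1" by (simp add: det_vector_2)
    have "\<exists>k. u = k *\<^sub>R v"
    proof (cases "v $ 1 = 0")
      case True
      then have "v $ 2 \<noteq> 0" using v by (auto simp: vec_eq_iff forall_2)
      then show ?thesis using d True
        by (intro exI[of _ "u $ 2 / v $ 2"]) (auto simp: vec_eq_iff forall_2 field_simps)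
    next
      case False
      then show ?thesis using d
        by (intro exI[of _ "u $ 1 / v $ 1"]) (auto simp: vec_eq_iff forall_2 field_simps)
    qed
    then show False using u by (auto simp: span_singleton)
  qed
next
  assume d: "det (vector [u, v] :: real^2^2) \<noteq> 0"
  then have "v \<noteq> 0" "u \<noteq> v" by (auto simp: det_vector_2)
  moreover have "u \<notin> span {v}"
    using d by (auto simp: span_singleton det_vector_2)
  ultimately show "u \<noteq> v \<and> independent {u, v}"
    by (simp add: independent_insert)
qed

lemma lattice_basis_iff_det:
  "lattice_basis L u v \<longleftrightarrow> det (vector [u, v] :: real^2^2) \<noteq> 0 \<and> L = int_span2 u v"
  unfolding lattice_basis_def using independent_pair_iff_det by blast

lemma plane_coordinates:
  fixes u v q :: "real^2"
  assumes "det (vector [u, v] :: real^2^2) \<noteq> 0"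
  obtains s t where "q = s *\<^sub>R u + t *\<^sub>R v"
proof
  define d where "d = u $ 1 * v $ 2 - u $ 2 * v $ 1"
  have "d \<noteq> 0" using assms by (simp add: d_def det_vector_2)
  \<comment> \<open>Cramer's rule with the denominator cleared.\<close>
  moreover have "d *\<^sub>R q = (q $ 1 * v $ 2 - q $ 2 * v $ 1) *\<^sub>R u + (u $ 1 * q $ 2 - u $ 2 * q $ 1) *\<^sub>R v"
    unfolding d_def by (simp add: vec_eq_iff forall_2 algebra_simps)
  then have "inverse d *\<^sub>R (d *\<^sub>R q) = inverse d *\<^sub>R ((q $ 1 * v $ 2 - q $ 2 * v $ 1) *\<^sub>R u
      + (u $ 1 * q $ 2 - u $ 2 * q $ 1) *\<^sub>R v)" by simp
  ultimately show "q = ((q $ 1 * v $ 2 - q $ 2 * v $ 1) / d) *\<^sub>R u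
      + ((u $ 1 * q $ 2 - u $ 2 * q $ 1) / d) *\<^sub>R v"
    by (simp add: scaleR_add_right divide_inverse mult.commute)
qed

lemma int_span2_memI: "of_int m *\<^sub>R u + of_int n *\<^sub>R v \<in> int_span2 u v"
  unfolding int_span2_def by blast

lemma int_span2_mem:
  "0 \<in> int_span2 u v" "u \<in> int_span2 u v" "v \<in> int_span2 u v" "u + v \<in> int_span2 u v"
  "v - u \<in> int_span2 u v"
  using int_span2_memI[of 0 u 0 v] int_span2_memI[of 1 u 0 v] int_span2_memI[of 0 u 1 v]
    int_span2_memI[of 1 u 1 v] int_span2_memI[of "-1" u 1 v]
  by simp_all

text \<open>The change of basis has matrix (0, 1; 1, -1) of determinant -1. It replaces the defining
  basis (x, z) of H(L) by (z, x - z), whose members have equal length.\<close>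

lemma int_span2_change: "int_span2 v (u - v) = int_span2 u v"
proof (intro equalityI subsetI)
  fix w assume "w \<in> int_span2 v (u - v)"
  then obtain m n :: int where "w = of_int m *\<^sub>R v + of_int n *\<^sub>R (u - v)"
    unfolding int_span2_def by blast
  then have "w = of_int n *\<^sub>R u + of_int (m - n) *\<^sub>R v" by (simp add: algebra_simps)
  then show "w \<in> int_span2 u v" by (metis int_span2_memI)
next
  fix w assume "w \<in> int_span2 u v"
  then obtain m n :: int where "w = of_int m *\<^sub>R u + of_int n *\<^sub>R v"
    unfolding int_span2_def by blast
  then have "w = of_int (m + n) *\<^sub>R v + of_int m *\<^sub>R (u - v)" by (simp add: algebra_simps)
  then show "w \<in> int_span2 v (u - v)" by (metis int_span2_memI)
qed

section \<open>Successive minima and determinant\<close>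

lemma dim_ge_1:
  assumes "(v :: real^2) \<in> S" "v \<noteq> 0"
  shows "1 \<le> dim S"
  using dim_subset[of "{v}" S] assms by simp

lemma successive_minimum_1_le:
  assumes "v \<in> L" "v \<noteq> 0"
  shows "successive_minimum L 1 \<le> norm v"
  unfolding successive_minimum_def
  by (rule cInf_lower) (use assms dim_ge_1[of v "L \<inter> cball 0 (norm v)"] in \<open>auto intro: bdd_belowI[of _ 0]\<close>)

lemma dim_ge_2:
  assumes "u \<in> S" "v \<in> S" "det (vector [u, v] :: real^2^2) \<noteq> 0"
  shows "2 \<le> dim S"
proof -
  have "u \<noteq> v" "independent {u, v}" using assms independent_pair_iff_det by auto
  then have "dim {u, v} = 2" by (simp add: dim_eq_card_independent)
  then show ?thesis using dim_subset[of "{u, v}" S] assms by simp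
qed

lemma successive_minimum_2_le:
  assumes "u \<in> L" "v \<in> L" "det (vector [u, v] :: real^2^2) \<noteq> 0"
  shows "successive_minimum L 2 \<le> max (norm u) (norm v)"
  unfolding successive_minimum_def
proof (rule cInf_lower)
  show "max (norm u) (norm v) \<in> {r. 0 \<le> r \<and> 2 \<le> dim (L \<inter> cball 0 r)}"
    using dim_ge_2[of u "L \<inter> cball 0 (max (norm u) (norm v))" v] assms
    by (auto simp: le_max_iff_disj)
qed (auto intro: bdd_belowI[of _ 0])

lemma successive_minimum_ge:
  assumes "\<And>w. w \<in> L \<Longrightarrow> w \<noteq> 0 \<Longrightarrow> R \<le> norm w"
    and "1 \<le> i" "u \<in> L" "v \<in> L" "det (vector [u, v] :: real^2^2) \<noteq> 0" "i \<le> 2"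
  shows "R \<le> successive_minimum L i"
  unfolding successive_minimum_def
proof (rule cInf_greatest)
  \<comment> \<open>\<open>cInf_greatest\<close> asks for a nonempty set; a ball containing both
    \<open>u\<close> and \<open>v\<close> supplies a radius for either value of
    \<open>i\<close>.\<close>
  have "max (norm u) (norm v) \<in> {r. 0 \<le> r \<and> i \<le> dim (L \<inter> cball 0 r)}"
    using dim_ge_2[of u "L \<inter> cball 0 (max (norm u) (norm v))" v] assms
    by (auto simp: le_max_iff_disj)
  then show "{r. 0 \<le> r \<and> i \<le> dim (L \<inter> cball 0 r)} \<noteq> {}" by blast
next
  fix r assume "r \<in> {r. 0 \<le> r \<and> i \<le> dim (L \<inter> cball 0 r)}"
  then have "1 \<le> dim (L \<inter> cball 0 r)" using \<open>1 \<le> i\<close> by simp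
  then have "\<not> L \<inter> cball 0 r \<subseteq> {0}" using dim_eq_0[of "L \<inter> cball 0 r"] by linarith
  then obtain w where "w \<in> L \<inter> cball 0 r" "w \<notin> {0}" by blast
  then have "w \<in> L" "w \<noteq> 0" "norm w \<le> r" by auto
  then show "R \<le> r" using assms(1)[of w] by linarith
qed

text \<open>Completing the square shows that the form is positive off the origin; being integral, it
  is then at least 1.\<close>

lemma sum_squares_minus_prod_ge_1:
  fixes m n :: int
  assumes "m \<noteq> 0 \<or> n \<noteq> 0"
  shows "1 \<le> m\<^sup>2 + n\<^sup>2 - \<bar>m * n\<bar>"
proof -
  have "4 * (m\<^sup>2 + n\<^sup>2 - \<bar>m\<bar> * \<bar>n\<bar>) = (2 * \<bar>m\<bar> - \<bar>n\<bar>)\<^sup>2 + 3 * \<bar>n\<bar>\<^sup>2"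
    by (simp add: power2_eq_square algebra_simps)
  moreover have "0 < (2 * \<bar>m\<bar> - \<bar>n\<bar>)\<^sup>2 + 3 * \<bar>n\<bar>\<^sup>2"
    using assms by (cases "n = 0") (auto intro: add_nonneg_pos)
  ultimately show ?thesis by (simp add: abs_mult)
qed

text \<open>With N = \<open>u \<bullet> u\<close>, the squared length of mu + nv is at least (m^2 +
  n^2 - |mn|) N, hence at least N. So no nonzero vector is shorter than \<open>u\<close>, and
  \<open>u\<close>, \<open>v\<close> together attain both minima.\<close>

lemma well_rounded_of_equal_norms:
  assumes basis: "lattice_basis L u v"
    and eq: "u \<bullet> u = v \<bullet> v" and bound: "2 * \<bar>u \<bullet> v\<bar> \<le> u \<bullet> u"
  shows "well_rounded L"
proof -
  have d: "det (vector [u, v] :: real^2^2) \<noteq> 0" and L: "L = int_span2 u v"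
    using basis by (auto simp: lattice_basis_iff_det)
  have mem: "u \<in> L" "v \<in> L" using L int_span2_mem by auto
  have short: "norm u \<le> norm w" if "w \<in> L" "w \<noteq> 0" for w
  proof -
    obtain m n :: int where w: "w = of_int m *\<^sub>R u + of_int n *\<^sub>R v"
      using \<open>w \<in> L\<close> unfolding L int_span2_def by blast
    with \<open>w \<noteq> 0\<close> have "m \<noteq> 0 \<or> n \<noteq> 0" by auto
    then have "1 \<le> real_of_int (m\<^sup>2 + n\<^sup>2 - \<bar>m * n\<bar>)"
      by (simp only: of_int_1_le_iff sum_squares_minus_prod_ge_1)
    then have "u \<bullet> u \<le> real_of_int (m\<^sup>2 + n\<^sup>2 - \<bar>m * n\<bar>) * (u \<bullet> u)"
      using mult_right_mono[of 1 _ "u \<bullet> u"] by simp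
    also have "\<dots> = (m\<^sup>2 + n\<^sup>2) * (u \<bullet> u) - \<bar>real_of_int (m * n)\<bar> * (u \<bullet> u)"
      by (simp add: algebra_simps)
    also have "\<dots> \<le> (m\<^sup>2 + n\<^sup>2) * (u \<bullet> u) - \<bar>real_of_int (m * n)\<bar> * (2 * \<bar>u \<bullet> v\<bar>)"
      using mult_left_mono[OF bound, of "\<bar>real_of_int (m * n)\<bar>"] by simp
    also have "\<dots> = (m\<^sup>2 + n\<^sup>2) * (u \<bullet> u) - \<bar>2 * (real_of_int (m * n) * (u \<bullet> v))\<bar>"
      by (simp add: abs_mult)
    also have "\<dots> \<le> (m\<^sup>2 + n\<^sup>2) * (u \<bullet> u) + 2 * (real_of_int (m * n) * (u \<bullet> v))"
      by linarith
    also have "\<dots> = w \<bullet> w"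
      unfolding w using eq
      by (simp add: inner_add_left inner_add_right inner_commute power2_eq_square algebra_simps)
    finally show ?thesis by (simp add: norm_le)
  qed
  have "successive_minimum L 1 \<le> norm u"
    using d mem by (intro successive_minimum_1_le) (auto simp: det_vector_2)
  moreover have "successive_minimum L 2 \<le> norm u"
    using successive_minimum_2_le[OF mem d] eq by (simp add: norm_eq_sqrt_inner)
  moreover have "norm u \<le> successive_minimum L 1" "norm u \<le> successive_minimum L 2"
    using successive_minimum_ge[OF short _ mem d] by auto
  ultimately show ?thesis
    using basis unfolding well_rounded_def is_lattice_def by auto
qed

lemma lattice_basis_det_multiple:
  assumes "lattice_basis L u v" "lattice_basis L u' v'"
  obtains k :: int where
    "det (vector [u', v'] :: real^2^2) = of_int k * det (vector [u, v] :: real^2^2)"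
proof -
  have "u' \<in> L" "v' \<in> L" "L = int_span2 u v"
    using assms int_span2_mem by (auto simp: lattice_basis_iff_det)
  then obtain m n p q :: int where "u' = of_int m *\<^sub>R u + of_int n *\<^sub>R v"
    "v' = of_int p *\<^sub>R u + of_int q *\<^sub>R v"
    unfolding int_span2_def by blast
  then have "det (vector [u', v'] :: real^2^2) = of_int (m * q - n * p) * det (vector [u, v] :: real^2^2)"
    by (simp add: det_vector_2 algebra_simps)
  then show ?thesis using that by blast
qed

text \<open>The determinants of two bases are integer multiples of each other, so the integer
  factors are units. This gives the uniqueness that \<open>THE\<close> requires.\<close>

lemma lattice_det_eq:
  assumes basis: "lattice_basis L u v"
  shows "lattice_det L = \<bar>det (vector [u, v] :: real^2^2)\<bar>"
  unfolding lattice_det_def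
proof (rule the_equality)
  show "\<exists>u' v'. lattice_basis L u' v' \<and>
      \<bar>det (vector [u, v] :: real^2^2)\<bar> = \<bar>det (vector [u', v'] :: real^2^2)\<bar>"
    using basis by blast
next
  fix d assume "\<exists>u' v'. lattice_basis L u' v' \<and> d = \<bar>det (vector [u', v'] :: real^2^2)\<bar>"
  then obtain u' v' where basis': "lattice_basis L u' v'"
    and d: "d = \<bar>det (vector [u', v'] :: real^2^2)\<bar>" by blast
  define D D' where "D = det (vector [u, v] :: real^2^2)" and "D' = det (vector [u', v'] :: real^2^2)"
  obtain k l :: int where k: "D' = of_int k * D" and l: "D = of_int l * D'"
    using lattice_basis_det_multiple basis basis' unfolding D_def D'_def by metis
  have "D \<noteq> 0" using basis by (simp add: D_def lattice_basis_iff_det)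
  moreover have "D = of_int (l * k) * D" using k l by (metis mult.assoc of_int_mult)
  ultimately have "l * k = 1" by (metis mult_cancel_right1 of_int_eq_1_iff)
  then have "\<bar>k\<bar> = 1" by (metis abs_zmult_eq_1 mult.commute abs_1)
  then have "\<bar>D'\<bar> = \<bar>D\<bar>" unfolding k by (simp add: abs_mult flip: of_int_abs)
  then show "d = \<bar>det (vector [u, v] :: real^2^2)\<bar>" by (simp add: d D_def D'_def)
qed

text \<open>A Gram matrix determines a basis up to isometry: the linear map sending basis to basis
  preserves norms once divided by the square root of \<kappa>.\<close>

lemma similar_to_of_proportional_gram:
  assumes b1: "lattice_basis L1 u v" and b2: "lattice_basis L2 u' v'"
    and \<kappa>: "\<kappa> > 0"
    and gram: "u' \<bullet> u' = \<kappa> * (u \<bullet> u)" "u' \<bullet> v' = \<kappa> * (u \<bullet> v)" "v' \<bullet> v' = \<kappa> * (v \<bullet> v)"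
  shows "similar_to L1 L2"
proof -
  have ind: "u \<noteq> v" "independent {u, v}" and L1: "L1 = int_span2 u v" and L2: "L2 = int_span2 u' v'"
    using b1 b2 by (auto simp: lattice_basis_def)
  obtain f where f: "linear f" "f u = u'" "f v = v'"
    using linear_independent_extend[OF ind(2), of "\<lambda>x. if x = u then u' else v'"] ind(1) by auto
  have f_comb: "f (s *\<^sub>R u + t *\<^sub>R v) = s *\<^sub>R u' + t *\<^sub>R v'" for s t
    using f by (simp add: linear_add linear_scale)
  define g where "g x = (1 / sqrt \<kappa>) *\<^sub>R f x" for x
  have "linear g" unfolding g_def using f(1) by (simp add: linear_compose_scale_right)
  moreover have "norm (g w) = norm w" for w
  proof -
    obtain s t where w: "w = s *\<^sub>R u + t *\<^sub>R v"
      using plane_coordinates b1 by (metis lattice_basis_iff_det)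
    have "f w \<bullet> f w = \<kappa> * (w \<bullet> w)"
      unfolding w f_comb using gram
      by (simp add: inner_add_left inner_add_right inner_commute algebra_simps)
    then have "norm (f w) = sqrt \<kappa> * norm w"
      by (simp add: norm_eq_sqrt_inner real_sqrt_mult)
    then show ?thesis using \<kappa> by (simp add: g_def)
  qed
  ultimately have "orthogonal_transformation g" by (simp add: orthogonal_transformation)
  then have "orthogonal_matrix (matrix g)" "linear g"
    by (simp_all add: orthogonal_transformation_matrix)
  moreover have "sqrt \<kappa> *\<^sub>R (matrix g *v x) = f x" for x
    using \<open>linear g\<close> \<kappa> by (simp add: matrix_works g_def)
  moreover have "f ` L1 = L2"
    unfolding L1 L2 int_span2_def image_def using f_comb by auto metis+
  ultimately show ?thesis
    unfolding similar_to_def using \<kappa> by (intro exI[of _ "sqrt \<kappa>"] exI[of _ "matrix g"]) simp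
qed

section \<open>The fundamental deep hole\<close>

text \<open>For w = mx + ny and the circumcenter z, the expression is |w - z|^2 - |z|^2. Only the
  cross term can be negative; when it is, the form is at least \<open>a\<close> times the integer
  m(m-1) + n(n-1) + mn.\<close>

lemma deep_hole_form_nonneg:
  fixes a b c :: real and m n :: int
  assumes "0 \<le> b" "2 * b \<le> a" "a \<le> c"
  shows "0 \<le> a * (m * (m - 1)) + c * (n * (n - 1)) + 2 * b * (m * n)"
proof -
  have pr: "0 \<le> k * (k - 1)" for k :: int
    by (cases "k \<le> 0") (auto intro: mult_nonpos_nonpos)
  have key: "0 \<le> m * (m - 1) + n * (n - 1) + m * n" if "m * n < 0"
  proof -
    have "m * (m - 1) + n * (n - 1) + m * n = (m + n)\<^sup>2 - (m + 1) * (n + 1) + 1"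
      by (simp add: power2_eq_square algebra_simps)
    \<comment> \<open>Opposite signs of integers: one of them is at least 1, the other at most -1,
      so the factors are positive and nonpositive.\<close>
    moreover have "(m + 1) * (n + 1) \<le> 0"
      using that by (auto simp: mult_less_0_iff mult_le_0_iff)
    moreover have "0 \<le> (m + n)\<^sup>2" by simp
    ultimately show ?thesis by linarith
  qed
  have "0 \<le> a" "0 \<le> c" using assms by auto
  have "0 \<le> real_of_int (m * (m - 1))" "0 \<le> real_of_int (n * (n - 1))"
    using pr[of m] pr[of n] by (simp_all only: of_int_0_le_iff)
  then have nn: "0 \<le> a * real_of_int (m * (m - 1))"
      "a * real_of_int (n * (n - 1)) \<le> c * real_of_int (n * (n - 1))"
      "0 \<le> c * real_of_int (n * (n - 1))"
    using \<open>0 \<le> a\<close> \<open>0 \<le> c\<close> assms(3) by (auto intro!: mult_nonneg_nonneg mult_right_mono)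
  show ?thesis
  proof (cases "m * n < 0")
    case False
    then have "0 \<le> real_of_int (m * n)" by (simp only: of_int_0_le_iff not_less)
    then have "0 \<le> 2 * b * real_of_int (m * n)" using assms(1) by simp
    then show ?thesis using nn by simp
  next
    case True
    then have "real_of_int (m * n) \<le> 0" by (simp only: of_int_le_0_iff)
    then have "a * real_of_int (m * n) \<le> 2 * b * real_of_int (m * n)"
      using assms(2) by (intro mult_right_mono_neg)
    moreover have "0 \<le> a * real_of_int (m * (m - 1) + n * (n - 1) + m * n)"
      using key[OF True] \<open>0 \<le> a\<close> by (intro mult_nonneg_nonneg) (simp_all only: of_int_0_le_iff)
    ultimately show ?thesis using nn by (simp add: distrib_left)
  qed
qed

text \<open>The hypotheses say that z is equidistant from 0, x and y; the weights on the left are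
  the barycentric coordinates of p.\<close>

lemma parallel_axis:
  fixes x y z :: "'a :: real_inner" and s t :: real
  assumes "2 * (z \<bullet> x) = x \<bullet> x" "2 * (z \<bullet> y) = y \<bullet> y"
  defines "p \<equiv> s *\<^sub>R x + t *\<^sub>R y"
  shows "(1 - s - t) * (dist p 0)\<^sup>2 + s * (dist p x)\<^sup>2 + t * (dist p y)\<^sup>2
    = (norm z)\<^sup>2 - (dist p z)\<^sup>2"
proof -
  have dist: "(dist p w)\<^sup>2 = p \<bullet> p - 2 * (p \<bullet> w) + w \<bullet> w" for w
    by (simp add: dist_norm power2_norm_eq_inner inner_diff_left inner_diff_right inner_commute)
  have pp: "p \<bullet> p = s * (p \<bullet> x) + t * (p \<bullet> y)"
    using inner_add_right[of p "s *\<^sub>R x" "t *\<^sub>R y"] by (simp flip: p_def)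
  have "2 * (p \<bullet> z) = s * (2 * (z \<bullet> x)) + t * (2 * (z \<bullet> y))"
    by (simp add: p_def inner_add_right inner_commute[of _ z])
  then have "2 * (p \<bullet> z) = s * (x \<bullet> x) + t * (y \<bullet> y)" by (simp only: assms(1,2))
  then show ?thesis
    unfolding dist power2_norm_eq_inner using pp by (simp add: algebra_simps)
qed

text \<open>With nonnegative weights of sum 1, the smallest of the three squared distances is at
  most their weighted mean. Keeping the term in \<open>dist p z\<close> later yields uniqueness of
  the deep hole.\<close>

lemma min_dist_le_circumradius:
  fixes x y z :: "'a :: real_inner"
  assumes "2 * (z \<bullet> x) = x \<bullet> x" "2 * (z \<bullet> y) = y \<bullet> y"
    and "0 \<le> s" "0 \<le> t" "s + t \<le> 1" and p: "p = s *\<^sub>R x + t *\<^sub>R y"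
  shows "\<exists>w\<in>{0, x, y}. (dist p w)\<^sup>2 \<le> (norm z)\<^sup>2 - (dist p z)\<^sup>2"
proof (rule ccontr)
  assume *: "\<not> ?thesis"
  define r where "r = (norm z)\<^sup>2 - (dist p z)\<^sup>2"
  have gt: "r < (dist p 0)\<^sup>2" "r < (dist p x)\<^sup>2" "r < (dist p y)\<^sup>2"
    using * unfolding r_def by (simp_all add: not_le)
  have "(1 - s - t) * r \<le> (1 - s - t) * (dist p 0)\<^sup>2" "s * r \<le> s * (dist p x)\<^sup>2"
      "t * r \<le> t * (dist p y)\<^sup>2"
    using gt assms by (auto intro!: mult_left_mono)
  \<comment> \<open>The weights sum to 1, so one of them is positive and its inequality is
    strict.\<close>
  moreover have "(1 - s - t) * r < (1 - s - t) * (dist p 0)\<^sup>2 \<or> s * r < s * (dist p x)\<^sup>2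
      \<or> t * r < t * (dist p y)\<^sup>2"
    using gt assms by (simp add: mult_less_cancel_left)
  moreover have "(1 - s - t) * r + s * r + t * r = r" by (simp add: algebra_simps)
  ultimately have "r < (1 - s - t) * (dist p 0)\<^sup>2 + s * (dist p x)\<^sup>2 + t * (dist p y)\<^sup>2"
    by linarith
  then show False using parallel_axis[OF assms(1,2), of s t] p by (simp add: r_def)
qed

text \<open>Gauss-reduced bases without an obtuse angle, described by inner products alone: minima
  and angles are thereby replaced by polynomial inequalities in the Gram entries.\<close>

locale acute_minimal_basis =
  fixes L :: "(real^2) set" and x y :: "real^2"
  assumes basis: "lattice_basis L x y"
    and acute: "0 \<le> x \<bullet> y" and reduced: "2 * (x \<bullet> y) \<le> x \<bullet> x" and ordered: "x \<bullet> x \<le> y \<bullet> y"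
begin

abbreviation "a \<equiv> x \<bullet> x"
abbreviation "b \<equiv> x \<bullet> y"
abbreviation "c \<equiv> y \<bullet> y"

definition gram_det :: real where "gram_det = a * c - b\<^sup>2"

text \<open>The coefficients are Cramer's solution of z . x = a/2, z . y = c/2. They are rational in
  the Gram entries, which also settles the claim about subfields.\<close>

definition circumcenter :: "real^2" where
  "circumcenter = (c * (a - b) / (2 * gram_det)) *\<^sub>R x + (a * (c - b) / (2 * gram_det)) *\<^sub>R y"

lemma det_nonzero: "det (vector [x, y] :: real^2^2) \<noteq> 0"
  and L_eq: "L = int_span2 x y"
  using basis by (auto simp: lattice_basis_iff_det)

lemma gram_det_pos: "0 < gram_det"
  unfolding gram_det_def det_squared_eq_gram[symmetric] using det_nonzero by simp

lemma a_pos: "0 < a" and b_less_c: "b < c"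
proof -
  show "0 < a" using det_nonzero by (auto simp: det_vector_2)
  then show "b < c" using reduced ordered acute by linarith
qed

lemma circumcenter_inner: "circumcenter \<bullet> x = a / 2" "circumcenter \<bullet> y = c / 2"
proof -
  have 1: "c * (a - b) * a + a * (c - b) * b = a * gram_det"
    and 2: "c * (a - b) * b + a * (c - b) * c = c * gram_det"
    by (simp_all add: gram_det_def power2_eq_square algebra_simps)
  have "circumcenter \<bullet> x = (c * (a - b) * a + a * (c - b) * b) / (2 * gram_det)"
    "circumcenter \<bullet> y = (c * (a - b) * b + a * (c - b) * c) / (2 * gram_det)"
    by (simp_all add: circumcenter_def inner_add_left inner_commute[of y x] add_divide_distrib)
  then show "circumcenter \<bullet> x = a / 2" "circumcenter \<bullet> y = c / 2"
    unfolding 1 2 using gram_det_pos by simp_all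
qed

text \<open>The classical R = (product of the sides) / (4 area), squared: a + c - 2b is the square
  of the third side, and the area is half the square root of \<open>gram_det\<close>.\<close>

lemma circumradius_squared: "circumcenter \<bullet> circumcenter = a * c * (a + c - 2 * b) / (4 * gram_det)"
proof -
  have "circumcenter \<bullet> circumcenter
      = (c * (a - b) / (2 * gram_det)) * (circumcenter \<bullet> x) + (a * (c - b) / (2 * gram_det)) * (circumcenter \<bullet> y)"
    by (subst (2) circumcenter_def) (simp add: inner_add_right)
  also have "\<dots> = a * c * (a + c - 2 * b) / (4 * gram_det)"
    unfolding circumcenter_inner using gram_det_pos by (simp add: field_simps)
  finally show ?thesis .
qed

lemma circumcenter_in_triangle: "circumcenter \<in> convex hull {0, x, y}"
proof -
  define s t where "s = c * (a - b) / (2 * gram_det)" and "t = a * (c - b) / (2 * gram_det)"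
  have "0 \<le> s" "0 \<le> t"
    using gram_det_pos a_pos b_less_c reduced acute by (simp_all add: s_def t_def)
  moreover have "s + t \<le> 1"
  proof -
    \<comment> \<open>This product is \<open>2 * gram_det * (1 - s - t)\<close>, the scaled
      barycentric coordinate at the vertex 0.\<close>
    have "0 \<le> b * ((a - b) + (c - b))"
      using acute reduced b_less_c by (intro mult_nonneg_nonneg) auto
    then have "c * (a - b) + a * (c - b) \<le> 2 * gram_det"
      by (simp add: gram_det_def power2_eq_square algebra_simps)
    then show ?thesis using gram_det_pos by (simp add: s_def t_def flip: add_divide_distrib)
  qed
  ultimately show ?thesis
    unfolding convex_hull_3 mem_Collect_eq circumcenter_def s_def[symmetric] t_def[symmetric]
    by - (rule exI[of _ "1 - s - t"], rule exI[of _ s], rule exI[of _ t], simp)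
qed

lemma vertex_near:
  assumes "0 \<le> s" "0 \<le> t" "s + t \<le> 1"
  obtains w where "w \<in> {0, x, y}"
    "(dist (s *\<^sub>R x + t *\<^sub>R y) w)\<^sup>2 \<le> (norm circumcenter)\<^sup>2 - (dist (s *\<^sub>R x + t *\<^sub>R y) circumcenter)\<^sup>2"
    "dist (s *\<^sub>R x + t *\<^sub>R y) w \<le> norm circumcenter"
proof -
  define p where "p = s *\<^sub>R x + t *\<^sub>R y"
  have "2 * (circumcenter \<bullet> x) = a" "2 * (circumcenter \<bullet> y) = c"
    using circumcenter_inner by simp_all
  then obtain w where w: "w \<in> {0, x, y}" "(dist p w)\<^sup>2 \<le> (norm circumcenter)\<^sup>2 - (dist p circumcenter)\<^sup>2"
    using min_dist_le_circumradius[OF _ _ assms p_def] by blast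
  then have "(dist p w)\<^sup>2 \<le> (norm circumcenter)\<^sup>2"
    using zero_le_power2[of "dist p circumcenter"] by linarith
  then have "dist p w \<le> norm circumcenter" by (rule power2_le_imp_le) simp
  then show ?thesis using w that unfolding p_def by blast
qed

lemma infdist_squared_le_of_triangle:
  assumes "p \<in> convex hull {0, x, y}"
  shows "(infdist p L)\<^sup>2 \<le> (norm circumcenter)\<^sup>2 - (dist p circumcenter)\<^sup>2"
proof -
  obtain r s t where rst: "0 \<le> r" "0 \<le> s" "0 \<le> t" "r + s + t = 1" and p: "p = s *\<^sub>R x + t *\<^sub>R y"
    using assms unfolding convex_hull_3 by auto
  have st: "s + t \<le> 1" using rst by linarith
  obtain w where w: "w \<in> {0, x, y}" "(dist p w)\<^sup>2 \<le> (norm circumcenter)\<^sup>2 - (dist p circumcenter)\<^sup>2"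
    using vertex_near[OF rst(2,3) st] unfolding p by metis
  have "w \<in> L" using w(1) int_span2_mem[where u = x and v = y] unfolding L_eq by blast
  then have "(infdist p L)\<^sup>2 \<le> (dist p w)\<^sup>2"
    by (intro power_mono infdist_le infdist_nonneg)
  then show ?thesis using w(2) by linarith
qed

lemma infdist_le_circumradius: "infdist q L \<le> norm circumcenter"
proof -
  obtain s t where q: "q = s *\<^sub>R x + t *\<^sub>R y" using plane_coordinates[OF det_nonzero] .
  define p where "p = frac s *\<^sub>R x + frac t *\<^sub>R y"
  obtain w where w: "w \<in> L" "dist p w \<le> norm circumcenter"
  \<comment> \<open>The diagonal from x to y cuts the fundamental parallelogram into the triangle
    and its image under p -> x + y - p, a symmetry of the lattice.\<close>
  proof (cases "frac s + frac t \<le> 1")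
    case True
    obtain w where "w \<in> {0, x, y}" "dist p w \<le> norm circumcenter"
      using vertex_near[OF frac_ge_0 frac_ge_0 True] unfolding p_def by blast
    then show ?thesis using that int_span2_mem[where u = x and v = y] unfolding L_eq by blast
  next
    case False
    define p' where "p' = (1 - frac s) *\<^sub>R x + (1 - frac t) *\<^sub>R y"
    have "0 \<le> 1 - frac s" "0 \<le> 1 - frac t" "(1 - frac s) + (1 - frac t) \<le> 1"
      using False frac_lt_1[of s] frac_lt_1[of t] by linarith+
    from vertex_near[OF this] obtain w where w: "w \<in> {0, x, y}" "dist p' w \<le> norm circumcenter"
      unfolding p'_def by blast
    have "x + y - w \<in> L" using w(1) int_span2_mem[where u = x and v = y] unfolding L_eq by auto
    moreover have "dist p (x + y - w) = dist p' w"
    proof -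
      have "p - (x + y - w) = - (p' - w)" by (simp add: p_def p'_def algebra_simps)
      then show ?thesis by (simp only: dist_norm norm_minus_cancel)
    qed
    ultimately show ?thesis using that w(2) by metis
  qed
  define e where "e = of_int \<lfloor>s\<rfloor> *\<^sub>R x + of_int \<lfloor>t\<rfloor> *\<^sub>R y"
  have "w + e \<in> L"
  proof -
    obtain m n :: int where "w = of_int m *\<^sub>R x + of_int n *\<^sub>R y"
      using w(1) unfolding L_eq int_span2_def by blast
    then have "w + e = of_int (m + \<lfloor>s\<rfloor>) *\<^sub>R x + of_int (n + \<lfloor>t\<rfloor>) *\<^sub>R y"
      by (simp add: e_def algebra_simps)
    then show ?thesis unfolding L_eq by (metis int_span2_memI)
  qed
  then have "infdist q L \<le> dist q (w + e)" by (rule infdist_le)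
  also have "\<dots> = dist p w"
    by (simp add: dist_norm q p_def e_def frac_def algebra_simps)
  finally show ?thesis using w(2) by linarith
qed

lemma infdist_circumcenter: "infdist circumcenter L = norm circumcenter"
proof (rule antisym[OF infdist_le_circumradius])
  have "L \<noteq> {}" using L_eq int_span2_mem(1) by blast
  moreover have "norm circumcenter \<le> dist circumcenter w" if "w \<in> L" for w
  proof -
    obtain m n :: int where w: "w = of_int m *\<^sub>R x + of_int n *\<^sub>R y"
      using \<open>w \<in> L\<close> unfolding L_eq int_span2_def by blast
    have "(circumcenter - w) \<bullet> (circumcenter - w)
        = circumcenter \<bullet> circumcenter + (w \<bullet> w - 2 * (circumcenter \<bullet> w))"
      by (simp add: inner_diff_left inner_diff_right inner_commute)
    \<comment> \<open>Since 2 (z . w) = am + cn, the squares m^2 and n^2 become m(m-1) and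
      n(n-1).\<close>
    also have "w \<bullet> w - 2 * (circumcenter \<bullet> w) = a * (m * (m - 1)) + c * (n * (n - 1)) + 2 * b * (m * n)"
      unfolding w by (simp add: inner_add_left inner_add_right circumcenter_inner inner_commute[of y x] algebra_simps)
    finally have "circumcenter \<bullet> circumcenter \<le> (circumcenter - w) \<bullet> (circumcenter - w)"
      using deep_hole_form_nonneg[OF acute reduced ordered, of m n] by simp
    then show ?thesis by (simp add: dist_norm norm_le)
  qed
  ultimately show "norm circumcenter \<le> infdist circumcenter L"
    unfolding infdist_def by (auto intro: cINF_greatest)
qed

text \<open>A deep hole p in the triangle has distance at least |z| from L, while the triangle bound
  is |z|^2 - |p - z|^2; hence p = z.\<close>

lemma fundamental_deep_hole_eq: "fundamental_deep_hole L x y = circumcenter"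
  unfolding fundamental_deep_hole_def
proof (rule the_equality)
  show "deep_hole L circumcenter \<and> circumcenter \<in> convex hull {0, x, y}"
    using circumcenter_in_triangle infdist_le_circumradius by (simp add: deep_hole_def infdist_circumcenter)
next
  fix p assume p: "deep_hole L p \<and> p \<in> convex hull {0, x, y}"
  then have "norm circumcenter \<le> infdist p L"
    unfolding deep_hole_def using infdist_circumcenter by metis
  then have "(norm circumcenter)\<^sup>2 \<le> (infdist p L)\<^sup>2" by (intro power_mono) auto
  then have "(dist p circumcenter)\<^sup>2 \<le> 0" using infdist_squared_le_of_triangle[of p] p by linarith
  then show "p = circumcenter" by simp
qed

section \<open>The deep hole lattice\<close>

lemma deep_hole_lattice_basis: "lattice_basis (deep_hole_lattice L x y) circumcenter (x - circumcenter)"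
proof -
  define t where "t = a * (c - b) / (2 * gram_det)"
  have "t \<noteq> 0" using a_pos b_less_c gram_det_pos by (simp add: t_def)
  \<comment> \<open>det(z, x - z) = det(z, x), to which only the y-component \<open>t\<close> of z
    contributes.\<close>
  moreover have "det (vector [circumcenter, x - circumcenter] :: real^2^2)
      = - (t * det (vector [x, y] :: real^2^2))"
    unfolding circumcenter_def t_def[symmetric] by (simp add: det_vector_2 algebra_simps)
  ultimately show ?thesis
    using det_nonzero
    by (simp add: lattice_basis_iff_det deep_hole_lattice_def fundamental_deep_hole_eq int_span2_change)
qed

lemma deep_hole_basis_gram:
  "(x - circumcenter) \<bullet> (x - circumcenter) = circumcenter \<bullet> circumcenter"
  "circumcenter \<bullet> (x - circumcenter) = a / 2 - circumcenter \<bullet> circumcenter"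
  using circumcenter_inner by (simp_all add: inner_diff_left inner_diff_right inner_commute[of x circumcenter])

text \<open>The side x is a shortest one, so its opposite angle is at most pi/3, and the law of
  sines gives R >= |x| / sqrt 3. The proof below is algebraic.\<close>

lemma circumradius_lower: "a \<le> 3 * (circumcenter \<bullet> circumcenter)"
proof -
  \<comment> \<open>A splitting of 3c(a + c - 2b) - 4(ac - b^2) into products of nonnegative
    factors; it vanishes in the hexagonal case a = c = 2b.\<close>
  have "0 \<le> (3 * c - a) * (c - a) + (a - 2 * b) * (3 * c - a - 2 * b)"
    using a_pos reduced ordered by (intro add_nonneg_nonneg mult_nonneg_nonneg; linarith)
  then have "4 * gram_det \<le> 3 * (c * (a + c - 2 * b))"
    by (simp add: gram_det_def power2_eq_square algebra_simps)
  then have "a * (4 * gram_det) \<le> a * (3 * (c * (a + c - 2 * b)))"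
    using a_pos by simp
  then show ?thesis
    unfolding circumradius_squared using gram_det_pos by (simp add: field_simps)
qed

lemma well_rounded_deep_hole_lattice:
  assumes "c * (a + c - 2 * b) \<le> 4 * gram_det"
  shows "well_rounded (deep_hole_lattice L x y)"
proof -
  have "a * (c * (a + c - 2 * b)) \<le> a * (4 * gram_det)" using assms a_pos by simp
  then have "circumcenter \<bullet> circumcenter \<le> a"
    unfolding circumradius_squared using gram_det_pos by (simp add: field_simps)
  \<comment> \<open>The absolute value unfolds into a <= 3|z|^2 and |z|^2 <= a.\<close>
  then have "2 * \<bar>circumcenter \<bullet> (x - circumcenter)\<bar> \<le> circumcenter \<bullet> circumcenter"
    using circumradius_lower deep_hole_basis_gram(2) by linarith
  then show ?thesis
    using deep_hole_basis_gram(1)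
    by (intro well_rounded_of_equal_norms[OF deep_hole_lattice_basis]) auto
qed

text \<open>From ac <= a^2 + b^2 and 2b <= a follows c <= 5a/4. Then c(a + c - 2b) <= 9ac/4, whereas
  4(ac - b^2) >= 4ac - a^2 >= 3ac.\<close>

lemma well_rounded_deep_hole_lattice_of_semi_stable:
  assumes "gram_det \<le> a\<^sup>2"
  shows "well_rounded (deep_hole_lattice L x y)"
proof (rule well_rounded_deep_hole_lattice)
  have ac: "a * c \<le> a * a + b * b"
    using assms by (simp add: gram_det_def power2_eq_square)
  have bb: "4 * (b * b) \<le> a * a"
    using mult_mono[OF reduced reduced] a_pos acute by simp
  have "a * c \<le> a * (5 / 4 * a)" using ac bb by simp
  then have "c \<le> 5 / 4 * a" using a_pos by (simp only: mult_le_cancel_left_pos)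
  moreover have "q * (p + q - 2 * r) \<le> 4 * (p * q - r\<^sup>2)"
    if "0 < p" "p \<le> q" "0 \<le> r" "4 * (r * r) \<le> p * p" "q \<le> 5 / 4 * p" for p q r :: real
  proof -
    have "q * q \<le> (5 / 4 * p) * q" "p * p \<le> p * q"
      using that by (auto intro: mult_right_mono mult_left_mono)
    moreover have "0 \<le> p * q" "0 \<le> r * q" using that by simp_all
    ultimately show ?thesis using that(4) by (simp add: power2_eq_square algebra_simps)
  qed
  ultimately show "c * (a + c - 2 * b) \<le> 4 * gram_det"
    unfolding gram_det_def using a_pos ordered acute bb by blast
qed

lemma similar_deep_hole_lattice:
  assumes "a = c"
  shows "similar_to (deep_hole_lattice L x y) L"
proof (rule similar_to_of_proportional_gram[OF deep_hole_lattice_basis basis])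
  have ab: "0 < a + b" using a_pos acute by linarith
  have "gram_det = (a - b) * (a + b)"
    using assms by (simp add: gram_det_def power2_eq_square algebra_simps)
  moreover have "a - b > 0" using b_less_c assms by simp
  ultimately have z: "circumcenter \<bullet> circumcenter = a * a / (2 * (a + b))"
    unfolding circumradius_squared using assms ab by (simp add: divide_simps) (simp add: algebra_simps)
  \<comment> \<open>To be used with p = a and e = a + b, so that e - p = b. The factor 2e/p is a /
    |z|^2, forced by the first Gram entry.\<close>
  have ratio: "2 * e / p * (p * p / (2 * e)) = p" "2 * e / p * (p / 2 - p * p / (2 * e)) = e - p"
    if "e \<noteq> 0" "p \<noteq> 0" for e p :: real
    using that by (simp_all add: field_simps)
  show "0 < 2 * (a + b) / a" using ab a_pos by simp
  show "x \<bullet> x = 2 * (a + b) / a * (circumcenter \<bullet> circumcenter)"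
    "y \<bullet> y = 2 * (a + b) / a * ((x - circumcenter) \<bullet> (x - circumcenter))"
    "x \<bullet> y = 2 * (a + b) / a * (circumcenter \<bullet> (x - circumcenter))"
    unfolding deep_hole_basis_gram z using ratio[of "a + b" a] ab a_pos assms by simp_all
qed

end

section \<open>Coordinates in a subfield\<close>

lemma real_subfield_closed:
  assumes K: "real_subfield K"
  shows "p \<in> K \<Longrightarrow> q \<in> K \<Longrightarrow> p + q \<in> K" "p \<in> K \<Longrightarrow> q \<in> K \<Longrightarrow> p - q \<in> K"
    "p \<in> K \<Longrightarrow> q \<in> K \<Longrightarrow> p * q \<in> K" "p \<in> K \<Longrightarrow> q \<in> K \<Longrightarrow> p / q \<in> K" "of_int k \<in> K"
proof -
  have basic: "0 \<in> K" "1 \<in> K" and diff: "\<And>p q. p \<in> K \<Longrightarrow> q \<in> K \<Longrightarrow> p - q \<in> K"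
    and mult: "\<And>p q. p \<in> K \<Longrightarrow> q \<in> K \<Longrightarrow> p * q \<in> K" and inv: "\<And>p. p \<in> K \<Longrightarrow> inverse p \<in> K"
    using K by (auto simp: real_subfield_def)
  have add: "p + q \<in> K" if "p \<in> K" "q \<in> K" for p q
    using diff[OF that(1) diff[OF basic(1) that(2)]] by simp
  show "p \<in> K \<Longrightarrow> q \<in> K \<Longrightarrow> p + q \<in> K" "p \<in> K \<Longrightarrow> q \<in> K \<Longrightarrow> p - q \<in> K"
    "p \<in> K \<Longrightarrow> q \<in> K \<Longrightarrow> p * q \<in> K" "p \<in> K \<Longrightarrow> q \<in> K \<Longrightarrow> p / q \<in> K"
    using add diff mult inv by (auto simp: divide_inverse)
  show "of_int k \<in> K"
    by (induction k rule: int_induct[of _ 0]) (use basic add diff in auto)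
qed

lemma (in acute_minimal_basis) deep_hole_lattice_subset_cartesian_square:
  assumes K: "real_subfield K" and L: "L \<subseteq> cartesian_square K"
  shows "deep_hole_lattice L x y \<subseteq> cartesian_square K"
proof -
  note closed = real_subfield_closed[OF K]
  have two: "2 \<in> K" using closed(5)[of 2] by simp
  have "x \<in> L" "y \<in> L" using L_eq int_span2_mem by auto
  then have xy: "x $ i \<in> K" "y $ i \<in> K" for i
    using L by (auto simp: cartesian_square_def)
  have inner: "a \<in> K" "b \<in> K" "c \<in> K"
    unfolding inner_real2 by (intro closed xy)+
  \<comment> \<open>Each coordinate is a rational expression in the coordinates of x and y.\<close>
  have "circumcenter $ i \<in> K" for i
    unfolding circumcenter_def gram_det_def power2_eq_square vector_add_component vector_scaleR_component real_scaleR_def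
    by (intro closed xy inner two)
  then show ?thesis
    unfolding deep_hole_lattice_def fundamental_deep_hole_eq int_span2_def cartesian_square_def
    using xy closed by auto
qed

section \<open>From minimal bases to reduced bases, and the theorem\<close>

lemma minimal_basis_reduced:
  assumes "minimal_basis L x y"
  shows "2 * (x \<bullet> y) \<le> x \<bullet> x"
proof -
  have basis: "lattice_basis L x y" and n: "norm x = successive_minimum L 1" "norm y = successive_minimum L 2"
    using assms by (auto simp: minimal_basis_def)
  have d: "det (vector [x, y] :: real^2^2) \<noteq> 0" and mem: "x \<in> L" "y - x \<in> L"
    using basis int_span2_mem by (auto simp: lattice_basis_iff_det)
  have "norm x \<le> norm (y - x)"
    unfolding n(1) using d mem by (intro successive_minimum_1_le) (auto simp: det_vector_2)
  \<comment> \<open>x and y - x are independent, so the longer one has length at least the second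
    minimum; by the previous bound that is y - x.\<close>
  moreover have "norm y \<le> max (norm x) (norm (y - x))"
    unfolding n(2) using mem d
    by (intro successive_minimum_2_le) (auto simp: det_vector_2 algebra_simps)
  ultimately have "norm y \<le> norm (y - x)" by simp
  then have "y \<bullet> y \<le> (y - x) \<bullet> (y - x)" by (simp add: norm_le)
  then show ?thesis by (simp add: inner_diff_left inner_diff_right inner_commute[of y x])
qed

theorem theorem1p1:
  fixes L :: "(real^2) set" and x1 x2 :: "real^2" and \<theta> \<alpha> :: real
  assumes "is_lattice L"
    and "minimal_basis L x1 x2"
    and "\<theta> = vec_angle x1 x2"
    and "pi / 3 \<le> \<theta>" and "\<theta> \<le> pi / 2"
    and "\<alpha> \<ge> 1"
    and "successive_minimum L 2 = \<alpha> * successive_minimum L 1"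
  shows "(\<alpha> \<le> 2 * sin (\<theta> + pi / 6) \<longrightarrow> well_rounded (deep_hole_lattice L x1 x2)) \<and>
    (semi_stable L \<longrightarrow> well_rounded (deep_hole_lattice L x1 x2)) \<and>
    (well_rounded L \<longrightarrow> similar_to (deep_hole_lattice L x1 x2) L) \<and>
    (\<forall>K. real_subfield K \<longrightarrow> L \<subseteq> cartesian_square K \<longrightarrow>
       deep_hole_lattice L x1 x2 \<subseteq> cartesian_square K)"
proof -
  have basis: "lattice_basis L x1 x2" and n: "norm x1 = successive_minimum L 1"
    "norm x2 = successive_minimum L 2"
    using assms(2) by (auto simp: minimal_basis_def)
  define l where "l = norm x1"
  have l: "0 < l" using basis by (auto simp: l_def lattice_basis_iff_det det_vector_2)
  have x2: "norm x2 = \<alpha> * l" using assms(7) n by (simp add: l_def)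
  have \<alpha>: "0 < \<alpha>" using assms(6) by simp
  \<comment> \<open>Places the argument in [-1, 1], where \<open>arccos\<close> inverts
    \<open>cos\<close>.\<close>
  have "\<bar>x1 \<bullet> x2 / (norm x1 * norm x2)\<bar> \<le> 1"
    using Cauchy_Schwarz_ineq2[of x1 x2] l \<alpha> x2 by (simp add: l_def[symmetric] abs_mult)
  then have "cos \<theta> = x1 \<bullet> x2 / (norm x1 * norm x2)"
    unfolding assms(3) vec_angle_def by (intro cos_arccos_abs)
  then have b: "x1 \<bullet> x2 = \<alpha> * l\<^sup>2 * cos \<theta>"
    using l \<alpha> x2 by (simp add: l_def[symmetric] field_simps power2_eq_square)
  have a: "x1 \<bullet> x1 = l\<^sup>2" and c: "x2 \<bullet> x2 = \<alpha>\<^sup>2 * l\<^sup>2"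
    using x2 by (simp_all add: l_def power_mult_distrib flip: power2_norm_eq_inner)
  have cos: "0 \<le> cos \<theta>"
    using assms(4,5) pi_gt_zero by (auto intro!: cos_ge_zero)
  interpret acute_minimal_basis L x1 x2
  proof
    show "x1 \<bullet> x1 \<le> x2 \<bullet> x2" using assms(6) l by (simp add: a c)
    show "0 \<le> x1 \<bullet> x2" using b cos \<alpha> l by simp
  qed (use basis minimal_basis_reduced[OF assms(2)] in auto)
  have 1: "well_rounded (deep_hole_lattice L x1 x2)" if "\<alpha> \<le> 2 * sin (\<theta> + pi / 6)"
  proof (rule well_rounded_deep_hole_lattice)
    \<comment> \<open>2 sin(\<theta> + pi/6) = sqrt 3 sin \<theta> + cos \<theta>. Isolating the
      root leaves two sides that may be squared, the left one being nonnegative.\<close>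
    have "\<alpha> - cos \<theta> \<le> sqrt 3 * sin \<theta>"
      using that by (simp add: sin_add sin_30 cos_30 algebra_simps)
    moreover have "0 \<le> \<alpha> - cos \<theta>" using assms(6) cos_le_one[of \<theta>] by linarith
    ultimately have "(\<alpha> - cos \<theta>)\<^sup>2 \<le> (sqrt 3 * sin \<theta>)\<^sup>2" by (intro power_mono)
    then have "1 + \<alpha>\<^sup>2 - 2 * (\<alpha> * cos \<theta>) \<le> 4 * (1 - (cos \<theta>)\<^sup>2)"
      by (simp add: power_mult_distrib sin_squared_eq power2_diff)
    \<comment> \<open>The factor restores the scale: the two sides become c(a + c - 2b) and
      \<open>4 * gram_det\<close>.\<close>
    then have "(\<alpha>\<^sup>2 * l\<^sup>2 * l\<^sup>2) * (1 + \<alpha>\<^sup>2 - 2 * (\<alpha> * cos \<theta>)) \<le> (\<alpha>\<^sup>2 * l\<^sup>2 * l\<^sup>2) * (4 * (1 - (cos \<theta>)\<^sup>2))"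
      by (intro mult_left_mono) auto
    then show "x2 \<bullet> x2 * (x1 \<bullet> x1 + x2 \<bullet> x2 - 2 * (x1 \<bullet> x2)) \<le> 4 * gram_det"
      unfolding gram_det_def a b c by (simp add: power2_eq_square algebra_simps)
  qed
  have 2: "well_rounded (deep_hole_lattice L x1 x2)" if "semi_stable L"
  proof (rule well_rounded_deep_hole_lattice_of_semi_stable)
    \<comment> \<open>Squaring twice turns semi-stability into det^2 <= a^2, and det^2 is the Gram
      determinant.\<close>
    have "sqrt \<bar>det (vector [x1, x2] :: real^2^2)\<bar> \<le> l"
      using that n lattice_det_eq[OF basis] by (simp add: semi_stable_def l_def)
    then have "\<bar>det (vector [x1, x2] :: real^2^2)\<bar> \<le> l\<^sup>2" by (rule sqrt_le_D)
    then have "\<bar>det (vector [x1, x2] :: real^2^2)\<bar>\<^sup>2 \<le> (l\<^sup>2)\<^sup>2" by (intro power_mono) auto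
    moreover have "gram_det = \<bar>det (vector [x1, x2] :: real^2^2)\<bar>\<^sup>2"
      by (simp add: gram_det_def det_squared_eq_gram)
    ultimately show "gram_det \<le> (x1 \<bullet> x1)\<^sup>2" by (simp only: a)
  qed
  have 3: "similar_to (deep_hole_lattice L x1 x2) L" if "well_rounded L"
    using that n by (intro similar_deep_hole_lattice) (simp add: well_rounded_def flip: norm_eq)
  show ?thesis using 1 2 3 deep_hole_lattice_subset_cartesian_square by blast
qed

end
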